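(* For every fixed integer $p\ge 0$ and every fixed integer $m\ge 1$, as $n\to\infty$, $$\sum_{k=1}^{n} \frac{(\log k)^p}{k} = \frac{1}{p+1} (\log n)^{p+1} +\gamma_p +\frac12\frac{(\log n)^p}{n} -\sum_{k=1}^m \frac{\sum_{r=0}^p d_{p,k,r}(\log n)^{p-r} }{n^{2k}} +O\Big(\frac {(\log n)^{p}}{n^{2m+1}}\Big),$$ where $d_{p,k,r}= \dfrac{B_{2k}}{2k}\, \dfrac{(-1)^r\, p!}{(p-r)!}\, S_{r,1,2k-1}$, and where, in formal notation, $$\gamma_p = (-1)^p\, p! \sum_{k>p/2} \frac{B_{2k}}{2k}\, S_{p,1,2k-1}$$ (for $p=0$ one needs to add $\frac12$ to the right-hand side of this formal expression). In particular, for $p=2$, $$\sum_{k=1}^{n} \frac{(\log k)^2}{k} = \frac{(\log n)^3}{3} +\gamma_2 +\frac12\frac{(\log n)^2}{n} -\sum_{k=1}^m \frac{B_{2k}}{2k}\,\frac{(\log n)^2 -2 H_{2k-1}\log n +H_{2k-1}^2-H^{(2)}_{2k-1}}{n^{2k}} +O\Big(\frac {(\log n)^{2}}{n^{2m+1}}\Big),$$ with, in formal notation, $\gamma_2=\sum_{k\ge1} \dfrac{B_{2k}\,(H_{2k-1}^2-H_{2k-1}^{(2)})}{2k}$.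
   Context: $B_{2k}$ are the Bernoulli numbers. $H_n=\sum_{k=1}^n\frac1k$ and $H_n^{(2)}=\sum_{k=1}^n\frac1{k^2}$. $\gamma_p=\lim_{N\to\infty}\big(\sum_{k=1}^N\frac{(\log k)^p}{k}-\frac{(\log N)^{p+1}}{p+1}\big)$ is the $p$-th Stieltjes constant, with $\gamma_0=\gamma$ (Euler's constant); $(\log 1)^0=1$. $S_{r,s,t}:=\sum_{s\le i_1<\dots<i_r\le t}\frac{1}{i_1\cdots i_r}$ (sum over integers), which is $0$ for $r\ge 1$ and $t<r+s-1$; $S_{0,s,t}:=1$ if $t\ge s-1$, and $S_{r,s,t}:=0$ if $r<0$. The infinite sums over Bernoulli numbers diverge; "in formal notation" means that such a sum is the formal expression for the constant term that arises when the Euler–Maclaurin formula is applied to the sum on the left-hand side from lower limit $1$ with all orders kept, and it stands for the exact value of that constant term. *)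

theory Defs
  imports "HOL-Analysis.Analysis"
begin

fun bernoulli_num :: "nat \<Rightarrow> real" where
  "bernoulli_num n =
     (if n = 0 then 1
      else - (\<Sum>k<n. real ((n + 1) choose k) * bernoulli_num k) / real (n + 1))"

declare bernoulli_num.simps [simp del]

definition bernoulli_poly :: "nat \<Rightarrow> real \<Rightarrow> real" where
  "bernoulli_poly n x = (\<Sum>k\<le>n. real (n choose k) * bernoulli_num k * x ^ (n - k))"

definition stieltjes :: "nat \<Rightarrow> real" where
  "stieltjes p =
     lim (\<lambda>N::nat. (\<Sum>k=1..N. ln (real k) ^ p / real k) - ln (real N) ^ (p + 1) / real (p + 1))"

definition harm2 :: "nat \<Rightarrow> real" where
  "harm2 n = (\<Sum>k=1..n. 1 / real k ^ 2)"

text \<open>The strictly increasing tuples \<open>s \<le> i\<^sub>1 < \<dots> < i\<^sub>r \<le> t\<close> are encoded as the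
  \<open>r\<close>-element subsets of \<open>{s..t}\<close>.\<close>

definition recip_sum :: "nat \<Rightarrow> nat \<Rightarrow> nat \<Rightarrow> real" where
  "recip_sum r s t = (\<Sum>A | A \<subseteq> {s..t} \<and> card A = r. \<Prod>i\<in>A. 1 / real i)"

definition d_coeff :: "nat \<Rightarrow> nat \<Rightarrow> nat \<Rightarrow> real" where
  "d_coeff p k r =
     bernoulli_num (2 * k) / real (2 * k) * ((- 1) ^ r * fact p / fact (p - r))
       * recip_sum r 1 (2 * k - 1)"

text \<open>The remainder of order \<open>m\<close> in the Euler--Maclaurin formula for \<open>f 1 + \<dots> + f n\<close>,
  with the periodic Bernoulli function of index \<open>2m + 1\<close> as kernel.\<close>

definition em_remainder :: "(real \<Rightarrow> real) \<Rightarrow> nat \<Rightarrow> nat \<Rightarrow> real" where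
  "em_remainder f m n =
     integral {1..real n} (\<lambda>x. bernoulli_poly (2 * m + 1) (frac x) * (deriv ^^ (2 * m + 1)) f x)
       / fact (2 * m + 1)"

text \<open>\<open>formal_em_constant f c K a C\<close> renders ``in formal notation,
  \<open>C = c + (\<Sum>k\<in>K. a k)\<close>'' for the constant term of the Euler--Maclaurin expansion of
  \<open>f 1 + \<dots> + f n\<close>. The series is in general divergent, so it is not summed. Instead:
  \<^item> Term by term, the expression consists of the contributions \<open>f 1 / 2\<close> and
    \<open>- B\<^sub>2\<^sub>k / (2k)! * f\<^bsup>(2k-1)\<^esup> 1\<close> of the lower limit \<open>1\<close> (for \<open>k \<notin> K\<close> the contribution is \<open>0\<close>).
  \<^item> The Euler--Maclaurin formula holds at every order \<open>m\<close>, with the terms at the upper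
    limit \<open>n\<close>, the expression truncated at \<open>k \<le> m\<close>, and the remainder.
  \<^item> \<open>C\<close> is the exact value of the constant term: at every order \<open>m\<close>, it is the truncated
    expression completed by the limit of the remainder.

  The integral is taken from \<open>1\<close> to \<open>n\<close>. It adds nothing to the constant term of an expansion
  written with the antiderivative of \<open>f\<close> that vanishes at \<open>1\<close>.\<close>

definition formal_em_constant ::
  "(real \<Rightarrow> real) \<Rightarrow> real \<Rightarrow> nat set \<Rightarrow> (nat \<Rightarrow> real) \<Rightarrow> real \<Rightarrow> bool" where
  "formal_em_constant f c K a C \<longleftrightarrow>
     c = f 1 / 2 \<and>
     (\<forall>k\<ge>1. - (bernoulli_num (2 * k) / fact (2 * k)) * (deriv ^^ (2 * k - 1)) f 1
              = (if k \<in> K then a k else 0)) \<and>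
     (\<forall>m n. n \<ge> 1 \<longrightarrow>
        (\<Sum>k=1..n. f (real k)) =
          integral {1..real n} f + f (real n) / 2
          + (\<Sum>k=1..m. bernoulli_num (2 * k) / fact (2 * k) * (deriv ^^ (2 * k - 1)) f (real n))
          + (c + (\<Sum>k\<in>K \<inter> {1..m}. a k)) + em_remainder f m n) \<and>
     (\<forall>m. (\<lambda>n. (c + (\<Sum>k\<in>K \<inter> {1..m}. a k)) + em_remainder f m n) \<longlonglongrightarrow> C)"

end

theory Submission
  imports Defs
begin

text \<open>The Euler--Maclaurin formula for \<open>f x = ln x ^ p / x\<close> on \<open>{1..n}\<close> carries the whole
  theorem, because all derivatives of \<open>f\<close> are explicit. Each differentiation of
  \<open>Q (ln x) / x ^ (j + 1)\<close> with a polynomial \<open>Q\<close> gives \<open>-(j + 1)\<close> times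
  \<open>(Q - Q' / (j + 1)) (ln x) / x ^ (j + 2)\<close>. Starting from \<open>Q y = y ^ p\<close>, the \<open>j\<close>-th derivative
  therefore comes from applying \<open>(1 - D / 1) (1 - D / 2) \<dots> (1 - D / j)\<close> to \<open>y ^ p\<close>, where
  \<open>D = d / dy\<close>. Expanding this product of operators produces the elementary symmetric
  functions of \<open>1, 1 / 2, \<dots>, 1 / j\<close>, that is \<open>recip_sum r 1 j\<close>, as the coefficients
  (\<open>log_poly\<close>, \<open>deriv_funpow_log_term\<close>). At the upper limit \<open>n\<close> this yields the coefficients
  \<open>d_coeff\<close>; at the lower limit \<open>1\<close>, where \<open>ln 1 = 0\<close>, only the term with \<open>r = p\<close> survives, and
  this yields the formal series for the Stieltjes constant.

  What remains is the size of the remainder integral. Its integrand is at most a constant times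
  \<open>ln x ^ p / x ^ (2 * m + 2)\<close>, and \<open>ln x ^ p / x\<close> is decreasing for \<open>x \<ge> exp p\<close>, so for large \<open>n\<close>, between \<open>n\<close> and
  \<open>N\<close> the remainder varies by at most a constant times \<open>ln n ^ p / n ^ (2 * m + 1)\<close>
  (\<open>em_remainder_log_term_tail\<close>). Hence the remainder converges at the claimed rate for
  every \<open>m \<ge> 1\<close>. Already \<open>m = 1\<close> shows that the limit defining \<open>stieltjes p\<close> exists; then at every
  order \<open>m\<close> the lower-limit terms and the remainder together must tend to \<open>stieltjes p\<close>, as all
  upper-limit terms vanish at infinity. The case \<open>p = 2\<close> is the general one rewritten with the
  identity \<open>2 * recip_sum 2 1 t = harm t ^ 2 - harm2 t\<close>.\<close>

section \<open>Bernoulli polynomials\<close>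

lemma bernoulli_num_0: "bernoulli_num 0 = 1"
  by (subst bernoulli_num.simps) simp

lemma bernoulli_num_1: "bernoulli_num (Suc 0) = - (1 / 2)"
  by (subst bernoulli_num.simps) (simp add: bernoulli_num_0)

lemma bernoulli_poly_0: "bernoulli_poly n 0 = bernoulli_num n"
proof -
  have "bernoulli_poly n 0 = (\<Sum>k\<in>{n}. real (n choose k) * bernoulli_num k * 0 ^ (n - k))"
    unfolding bernoulli_poly_def by (rule sum.mono_neutral_right) auto
  thus ?thesis by simp
qed

lemma bernoulli_poly_1: "bernoulli_poly (Suc (Suc n)) 1 = bernoulli_num (Suc (Suc n))"
proof -
  have "(\<Sum>k<Suc n. real (Suc (Suc n) choose k) * bernoulli_num k) =
          -(real (Suc (Suc n)) * bernoulli_num (Suc n))"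
    by (subst (2) bernoulli_num.simps) (simp del: of_nat_Suc binomial_Suc_Suc)
  moreover have "{..Suc (Suc n)} = insert (Suc (Suc n)) (insert (Suc n) {..<Suc n})" by auto
  ultimately show ?thesis
    by (simp add: bernoulli_poly_def del: binomial_Suc_Suc of_nat_Suc)
qed

lemma bernoulli_poly_eq_endpoints:
  "bernoulli_poly (Suc (Suc n)) 1 = bernoulli_poly (Suc (Suc n)) 0"
  by (simp only: bernoulli_poly_0 bernoulli_poly_1)

lemma has_real_derivative_bernoulli_poly:
  "(bernoulli_poly (Suc n) has_real_derivative real (Suc n) * bernoulli_poly n x) (at x within S)"
proof -
  have *: "real (Suc n choose k) * real (Suc n - k) = real (Suc n) * real (n choose k)" for k
    using binomial_absorb_comp[of "Suc n" k]
    by (metis diff_Suc_1 mult.commute of_nat_mult)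
  have "((\<lambda>x. \<Sum>k\<le>Suc n. real (Suc n choose k) * bernoulli_num k * x ^ (Suc n - k))
      has_real_derivative
        (\<Sum>k\<le>Suc n. real (Suc n choose k) * bernoulli_num k * (real (Suc n - k) * x ^ (Suc n - k - 1))))
      (at x within S)"
    by (auto intro!: derivative_eq_intros sum.cong simp del: binomial_Suc_Suc of_nat_Suc)
  also have "(\<Sum>k\<le>Suc n. real (Suc n choose k) * bernoulli_num k * (real (Suc n - k) * x ^ (Suc n - k - 1)))
     = (\<Sum>k\<le>Suc n. real (Suc n) * (real (n choose k) * bernoulli_num k * x ^ (n - k)))"
  proof (rule sum.cong[OF refl])
    fix k
    show "real (Suc n choose k) * bernoulli_num k * (real (Suc n - k) * x ^ (Suc n - k - 1)) =
      real (Suc n) * (real (n choose k) * bernoulli_num k * x ^ (n - k))"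
      using arg_cong[OF *[of k], of "\<lambda>t. t * (bernoulli_num k * x ^ (n - k))"]
      by (simp add: mult_ac del: binomial_Suc_Suc of_nat_Suc)
  qed
  also have "\<dots> = real (Suc n) * bernoulli_poly n x"
    unfolding bernoulli_poly_def by (simp add: sum_distrib_left del: of_nat_Suc)
  finally show ?thesis
    by (simp add: bernoulli_poly_def [abs_def] del: of_nat_Suc)
qed

lemma continuous_on_bernoulli_poly [continuous_intros]:
  assumes "continuous_on S g" shows "continuous_on S (\<lambda>x. bernoulli_poly n (g x))"
  unfolding bernoulli_poly_def using assms by (intro continuous_intros)

text \<open>The difference \<open>h n\<close> of the two sides satisfies \<open>h (n + 1)' = (n + 1) * h n\<close>. If \<open>h n\<close> vanishes
  identically, then \<open>h (n + 1)\<close> is a constant and \<open>h (n + 2)\<close> has constant slope. But \<open>h (n + 2)\<close> takes the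
  same value at \<open>0\<close> and \<open>1\<close>, because a Bernoulli polynomial of index at least \<open>2\<close> does, so the slope
  and with it the constant are \<open>0\<close>. Looking two indices ahead replaces the usual normalisation of
  the integral over the unit interval.\<close>

lemma bernoulli_poly_reflect: "bernoulli_poly n (1 - x) = (-1) ^ n * bernoulli_poly n x"
proof (induction n arbitrary: x)
  case 0
  show ?case by (simp add: bernoulli_poly_def)
next
  case (Suc n)
  define h where "h j x = (-1) ^ j * bernoulli_poly j (1 - x) - bernoulli_poly j x" for j x
  have dh: "(h (Suc j) has_real_derivative real (Suc j) * h j x) (at x)" for j x
    unfolding h_def
    by (auto intro!: derivative_eq_intros DERIV_chain2[OF has_real_derivative_bernoulli_poly]
        has_real_derivative_bernoulli_poly simp: algebra_simps)
  have "h n y = 0" for y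
    using Suc.IH[of y] by (simp add: h_def mult.assoc[symmetric] flip: power_add)
  hence const: "h (Suc n) y = h (Suc n) x" for y
    using DERIV_isconst_all[of "h (Suc n)" y x] dh[of n] by simp
  obtain z where "h (Suc (Suc n)) 1 - h (Suc (Suc n)) 0 = (1 - 0) * (real (Suc (Suc n)) * h (Suc n) z)"
    using MVT2[of 0 1 "h (Suc (Suc n))" "\<lambda>z. real (Suc (Suc n)) * h (Suc n) z", OF _ dh] by auto
  moreover have "h (Suc (Suc n)) 1 = h (Suc (Suc n)) 0"
    by (simp add: h_def bernoulli_poly_eq_endpoints)
  ultimately have "h (Suc n) x = 0"
    using const[of z] by (simp del: of_nat_Suc)
  hence "(-1) ^ Suc n * ((-1) ^ Suc n * bernoulli_poly (Suc n) (1 - x)) = (-1) ^ Suc n * bernoulli_poly (Suc n) x"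
    by (simp add: h_def)
  thus ?case by (simp only: mult.assoc[symmetric] flip: power_add) simp
qed

lemma bernoulli_num_odd: "bernoulli_num (2 * m + 3) = 0"
proof -
  have "bernoulli_num (Suc (Suc (2 * m + 1))) = (-1) ^ (Suc (Suc (2 * m + 1))) * bernoulli_num (Suc (Suc (2 * m + 1)))"
    using bernoulli_poly_reflect[of "Suc (Suc (2 * m + 1))" 0]
    by (simp only: bernoulli_poly_0 bernoulli_poly_1 diff_0_right)
  moreover have "(-1 :: real) ^ (Suc (Suc (2 * m + 1))) = -1" by simp
  ultimately show ?thesis by (simp add: eval_nat_numeral)
qed

section \<open>The Euler--Maclaurin formula\<close>

text \<open>Integration by parts with \<open>bernoulli_poly (Suc j) / fact (Suc j)\<close> as an antiderivative of
  \<open>bernoulli_poly j / fact j\<close>.\<close>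

lemma euler_maclaurin_unit_step:
  fixes g g' :: "real \<Rightarrow> real" and a :: real
  assumes "\<And>x. x \<in> {a..a+1} \<Longrightarrow> (g has_real_derivative g' x) (at x)"
      and "continuous_on {a..a+1} g'"
  shows "integral {a..a+1} (\<lambda>x. bernoulli_poly j (x - a) * g x) / fact j =
           (bernoulli_poly (Suc j) 1 * g (a + 1) - bernoulli_poly (Suc j) 0 * g a) / fact (Suc j)
           - integral {a..a+1} (\<lambda>x. bernoulli_poly (Suc j) (x - a) * g' x) / fact (Suc j)"
proof -
  let ?B = "\<lambda>x. bernoulli_poly (Suc j) (x - a)"
  have g: "continuous_on {a..a+1} g"
    by (meson DERIV_continuous_on assms(1) has_field_derivative_at_within)
  have d: "(?B has_real_derivative real (Suc j) * bernoulli_poly j (x - a)) (at x within S)" for x S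
  proof -
    have "((\<lambda>x. x - a) has_real_derivative 1) (at x within S)"
      by (auto intro!: derivative_eq_intros)
    from DERIV_chain2[OF has_real_derivative_bernoulli_poly this] show ?thesis
      by (simp del: of_nat_Suc)
  qed
  have "((\<lambda>x. real (Suc j) * bernoulli_poly j (x - a) * g x + g' x * ?B x)
      has_integral ?B (a + 1) * g (a + 1) - ?B a * g a) {a..a+1}"
  proof (rule fundamental_theorem_of_calculus)
    fix x assume "x \<in> {a..a+1}"
    hence "((\<lambda>x. ?B x * g x) has_real_derivative
        real (Suc j) * bernoulli_poly j (x - a) * g x + g' x * ?B x) (at x within {a..a+1})"
      by (intro DERIV_mult d has_field_derivative_at_within[OF assms(1)])
    thus "((\<lambda>x. ?B x * g x) has_vector_derivative
        real (Suc j) * bernoulli_poly j (x - a) * g x + g' x * ?B x) (at x within {a..a+1})"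
      by (simp add: has_real_derivative_iff_has_vector_derivative)
  qed simp
  moreover have "((\<lambda>x. real (Suc j) * (bernoulli_poly j (x - a) * g x) + ?B x * g' x) has_integral
      real (Suc j) * integral {a..a+1} (\<lambda>x. bernoulli_poly j (x - a) * g x)
       + integral {a..a+1} (\<lambda>x. ?B x * g' x)) {a..a+1}"
    by (intro has_integral_add has_integral_mult_right integrable_integral integrable_continuous_interval
        continuous_intros g assms(2))
  ultimately have "real (Suc j) * integral {a..a+1} (\<lambda>x. bernoulli_poly j (x - a) * g x)
       + integral {a..a+1} (\<lambda>x. ?B x * g' x) = ?B (a + 1) * g (a + 1) - ?B a * g a"
    by (simp add: has_integral_unique mult_ac)
  hence "?B (a + 1) * g (a + 1) - ?B a * g a - integral {a..a+1} (\<lambda>x. ?B x * g' x)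
      = real (Suc j) * integral {a..a+1} (\<lambda>x. bernoulli_poly j (x - a) * g x)" by linarith
  hence "(?B (a + 1) * g (a + 1) - ?B a * g a - integral {a..a+1} (\<lambda>x. ?B x * g' x)) / fact (Suc j)
      = real (Suc j) * integral {a..a+1} (\<lambda>x. bernoulli_poly j (x - a) * g x) / (real (Suc j) * fact j)"
    by (simp only: fact_Suc of_nat_mult of_nat_fact)
  also have "\<dots> = integral {a..a+1} (\<lambda>x. bernoulli_poly j (x - a) * g x) / fact j"
    by (simp del: of_nat_Suc)
  finally show ?thesis by (simp add: diff_divide_distrib del: of_nat_Suc fact_Suc)
qed

text \<open>On each \<open>{a..a + 1}\<close> with \<open>a\<close> an integer, \<open>frac x\<close> differs from \<open>x - a\<close> only at the right end
  point, so the discontinuities of the periodic kernel do not affect the integral.\<close>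

lemma has_integral_periodic_kernel:
  fixes B g :: "real \<Rightarrow> real"
  assumes "continuous_on {0..1} B" "continuous_on {1..} g" "n \<ge> 1"
  shows "((\<lambda>x. B (frac x) * g x) has_integral
           (\<Sum>a=1..<n. integral {real a..real a + 1} (\<lambda>x. B (x - real a) * g x))) {1..real n}"
  using assms(3)
proof (induction n rule: dec_induct)
  case base
  show ?case using has_integral_refl(2)[of _ "1::real"] by simp
next
  case (step n)
  let ?I = "integral {real n..real n + 1} (\<lambda>x. B (x - real n) * g x)"
  have "((\<lambda>x. B (x - real n) * g x) has_integral ?I) {real n..real n + 1}"
    using step.hyps
    by (intro integrable_integral integrable_continuous_interval continuous_intros
        continuous_on_compose2[OF assms(1)] continuous_on_subset[OF assms(2)]) auto
  hence "((\<lambda>x. B (frac x) * g x) has_integral ?I) {real n..real n + 1}"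
  proof (rule has_integral_spike_finite[of "{real n + 1}", rotated 2])
    fix x assume "x \<in> {real n..real n + 1} - {real n + 1}"
    hence "frac x = x - real n" by (subst frac_unique_iff) auto
    thus "B (frac x) * g x = B (x - real n) * g x" by simp
  qed simp
  hence "((\<lambda>x. B (frac x) * g x) has_integral
      ((\<Sum>a=1..<n. integral {real a..real a + 1} (\<lambda>x. B (x - real a) * g x)) + ?I)) {1..real n + 1}"
    using step by (intro has_integral_combine[OF _ _ step.IH]) auto
  thus ?case using step.hyps by (simp add: add.commute)
qed

text \<open>The normalised integrals \<open>T j\<close> satisfy a recursion by the integration by parts on unit intervals.
  For \<open>j \<ge> 1\<close> both end values of the next Bernoulli polynomial agree, and the boundary terms telescope.
  For \<open>j = 0\<close> they are \<open>- 1 / 2\<close> and \<open>1 / 2\<close>, which turns them into the trapezoidal sum. Two steps of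
  the recursion lead from \<open>T (2 * m + 1)\<close> to \<open>T (2 * m + 3)\<close>, where the second boundary term
  vanishes because Bernoulli numbers of odd index at least \<open>3\<close> are zero.\<close>

lemma euler_maclaurin:
  fixes f :: "real \<Rightarrow> real"
  assumes smooth: "\<And>j x. x \<ge> 1 \<Longrightarrow> ((deriv ^^ j) f has_real_derivative (deriv ^^ Suc j) f x) (at x)"
      and n: "n \<ge> 1"
  shows "(\<Sum>k=1..n. f (real k)) = integral {1..real n} f + (f 1 + f (real n)) / 2
           + (\<Sum>k=1..m. bernoulli_num (2 * k) / fact (2 * k)
                * ((deriv ^^ (2 * k - 1)) f (real n) - (deriv ^^ (2 * k - 1)) f 1))
           + em_remainder f m n"
proof -
  let ?g = "\<lambda>j. (deriv ^^ j) f"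
  define T where "T j = integral {1..real n} (\<lambda>x. bernoulli_poly j (frac x) * ?g j x) / fact j" for j
  have cont: "continuous_on {1..} (?g j)" for j
    by (rule DERIV_continuous_on) (auto intro: has_field_derivative_at_within smooth)
  have T: "T j = (\<Sum>a=1..<n. integral {real a..real a + 1}
                     (\<lambda>x. bernoulli_poly j (x - real a) * ?g j x) / fact j)" for j
    unfolding T_def sum_divide_distrib[symmetric]
    by (subst integral_unique[OF has_integral_periodic_kernel[OF _ cont n]])
       (auto intro!: continuous_intros)
  have step: "T j = (\<Sum>a=1..<n. bernoulli_poly (Suc j) 1 * ?g j (real (Suc a))
                 - bernoulli_poly (Suc j) 0 * ?g j (real a)) / fact (Suc j) - T (Suc j)" for j
    unfolding T sum_divide_distrib sum_subtractf[symmetric]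
  proof (rule sum.cong[OF refl])
    fix a assume a: "a \<in> {1..<n}"
    have d: "(?g j has_real_derivative ?g (Suc j) x) (at x)" if "x \<in> {real a..real a + 1}" for x
      using that a by (intro smooth) auto
    have c: "continuous_on {real a..real a + 1} (?g (Suc j))"
      using a by (intro continuous_on_subset[OF cont]) auto
    show "integral {real a..real a + 1} (\<lambda>x. bernoulli_poly j (x - real a) * ?g j x) / fact j =
       (bernoulli_poly (Suc j) 1 * ?g j (real (Suc a)) - bernoulli_poly (Suc j) 0 * ?g j (real a)) / fact (Suc j)
        - integral {real a..real a + 1} (\<lambda>x. bernoulli_poly (Suc j) (x - real a) * ?g (Suc j) x) / fact (Suc j)"
      using euler_maclaurin_unit_step[OF d c, of j]
      by (simp add: add.commute del: funpow.simps fact_Suc)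
  qed
  have tele: "(\<Sum>a=1..<n. h (Suc a) - h a) = h n - h 1" for h :: "nat \<Rightarrow> real"
    using sum_Suc_diff'[OF n, of h] by simp
  have step2: "T (Suc j) = bernoulli_num (Suc (Suc j)) / fact (Suc (Suc j)) *
                 (?g (Suc j) (real n) - ?g (Suc j) 1) - T (Suc (Suc j))" for j
    using tele[of "\<lambda>a. bernoulli_num (Suc (Suc j)) * ?g (Suc j) (real a)"]
    by (subst step, subst bernoulli_poly_0, subst bernoulli_poly_1)
       (simp add: right_diff_distrib diff_divide_distrib del: funpow.simps fact_Suc)
  have B1: "bernoulli_poly (Suc 0) 0 = - (1 / 2)" "bernoulli_poly (Suc 0) 1 = 1 / 2"
    by (simp_all add: bernoulli_poly_def bernoulli_num_0 bernoulli_num_1)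
  have "T 0 = (\<Sum>a=1..<n. f (real (Suc a)) + f (real a)) / 2 - T 1"
    by (subst step) (simp add: B1 sum_divide_distrib add_divide_distrib sum.distrib)
  also have "(\<Sum>a=1..<n. f (real (Suc a)) + f (real a)) = 2 * (\<Sum>k=1..n. f (real k)) - f 1 - f (real n)"
    using n by (induction n rule: dec_induct) simp_all
  finally have "(\<Sum>k=1..n. f (real k)) = integral {1..real n} f + (f 1 + f (real n)) / 2 + T 1"
    by (simp add: T_def bernoulli_poly_def bernoulli_num_0 bernoulli_num_1 field_simps)
  also have "T 1 = (\<Sum>k=1..m. bernoulli_num (2 * k) / fact (2 * k)
                * (?g (2 * k - 1) (real n) - ?g (2 * k - 1) 1)) + T (2 * m + 1)"
  proof (induction m)
    case (Suc m)
    have "T (2 * m + 1) = bernoulli_num (2 * Suc m) / fact (2 * Suc m) *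
                 (?g (2 * Suc m - 1) (real n) - ?g (2 * Suc m - 1) 1) - T (2 * m + 2)"
      using step2[of "2 * m"] by (simp del: funpow.simps fact_Suc)
    moreover have "T (2 * m + 2) = - T (2 * Suc m + 1)"
      using step2[of "2 * m + 1"] bernoulli_num_odd[of m]
      by (simp add: eval_nat_numeral del: funpow.simps fact_Suc)
    ultimately show ?case using Suc.IH by (simp del: funpow.simps fact_Suc)
  qed simp
  also have "T (2 * m + 1) = em_remainder f m n"
    by (simp add: T_def em_remainder_def)
  finally show ?thesis by simp
qed

section \<open>Elementary symmetric sums of reciprocals\<close>

lemma recip_sum_0: "recip_sum 0 s t = 1"
proof -
  have "{A. A \<subseteq> {s..t} \<and> card A = 0} = {{}}"
    by (auto simp: card_eq_0_iff dest: finite_subset)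
  thus ?thesis by (simp add: recip_sum_def)
qed

lemma recip_sum_eq_0: "t < r \<Longrightarrow> recip_sum r 1 t = 0"
proof -
  assume "t < r"
  hence "card A \<noteq> r" if "A \<subseteq> {1..t}" for A
    using card_mono[OF _ that] by simp
  hence "{A. A \<subseteq> {1..t} \<and> card A = r} = {}" by blast
  thus ?thesis by (simp only: recip_sum_def sum.empty)
qed

text \<open>A subset of \<open>{1..Suc t}\<close> with \<open>Suc r\<close> elements either avoids \<open>Suc t\<close> or arises from a subset of
  \<open>{1..t}\<close> with \<open>r\<close> elements by inserting \<open>Suc t\<close>.\<close>

lemma recip_sum_Suc:
  "recip_sum (Suc r) 1 (Suc t) = recip_sum (Suc r) 1 t + recip_sum r 1 t / real (Suc t)"
proof -
  define S where "S r = {A. A \<subseteq> {1..t} \<and> card A = r}" for r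
  have fin: "finite (S r)" for r unfolding S_def by simp
  have ins: "{1..Suc t} = insert (Suc t) {1..t}" by auto
  have nin: "Suc t \<notin> A" "finite A" if "A \<in> S r" for A r
    using that unfolding S_def by (auto dest: finite_subset)
  have "{A. A \<subseteq> {1..Suc t} \<and> card A = Suc r} = S (Suc r) \<union> insert (Suc t) ` S r" (is "?L = ?R")
  proof (intro equalityI subsetI)
    fix A assume A: "A \<in> ?L"
    hence [simp]: "finite A" by (auto dest: finite_subset)
    show "A \<in> ?R"
    proof (cases "Suc t \<in> A")
      case True
      hence "A = insert (Suc t) (A - {Suc t})" by auto
      moreover have "A - {Suc t} \<in> S r" using A True unfolding S_def ins by auto
      ultimately show ?thesis by blast
    next
      case False
      thus ?thesis using A unfolding S_def ins by auto
    qed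
  next
    fix A assume "A \<in> ?R"
    thus "A \<in> ?L"
    proof
      assume "A \<in> S (Suc r)" thus ?thesis unfolding S_def ins by auto
    next
      assume "A \<in> insert (Suc t) ` S r"
      then obtain A' where A': "A' \<in> S r" "A = insert (Suc t) A'" by blast
      thus ?thesis using nin[OF A'(1)] unfolding S_def ins by auto
    qed
  qed
  hence "recip_sum (Suc r) 1 (Suc t) = (\<Sum>A\<in>S (Suc r) \<union> insert (Suc t) ` S r. \<Prod>i\<in>A. 1 / real i)"
    by (simp add: recip_sum_def)
  also have "\<dots> = (\<Sum>A\<in>S (Suc r). \<Prod>i\<in>A. 1 / real i) + (\<Sum>A\<in>insert (Suc t) ` S r. \<Prod>i\<in>A. 1 / real i)"
    using nin(1) by (intro sum.union_disjoint fin finite_imageI) blast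
  also have "(\<Sum>A\<in>insert (Suc t) ` S r. \<Prod>i\<in>A. 1 / real i) = (\<Sum>A\<in>S r. \<Prod>i\<in>insert (Suc t) A. 1 / real i)"
  proof (rule sum.reindex_cong[OF _ refl refl], rule inj_onI)
    fix A A' assume "A \<in> S r" "A' \<in> S r" "insert (Suc t) A = insert (Suc t) A'"
    thus "A = A'" using nin(1) insert_ident by metis
  qed
  also have "\<dots> = (\<Sum>A\<in>S r. (\<Prod>i\<in>A. 1 / real i) / real (Suc t))"
    by (rule sum.cong[OF refl], subst prod.insert) (use nin in auto)
  finally show ?thesis by (simp add: recip_sum_def S_def sum_divide_distrib)
qed

lemma recip_sum_1: "recip_sum 1 1 t = harm t"
proof (induction t)
  case 0
  show ?case by (simp only: recip_sum_eq_0) (simp add: harm_def)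
next
  case (Suc t)
  thus ?case
    using recip_sum_Suc[of 0 t] by (simp add: recip_sum_0 harm_Suc inverse_eq_divide)
qed

lemma recip_sum_2: "2 * recip_sum 2 1 t = harm t ^ 2 - harm2 t"
proof (induction t)
  case 0
  show ?case by (simp only: recip_sum_eq_0) (simp add: harm_def harm2_def)
next
  case (Suc t)
  define u where "u = 1 / real (Suc t)"
  have "recip_sum 2 1 (Suc t) = recip_sum 2 1 t + harm t * u"
    using recip_sum_Suc[of 1 t] recip_sum_1[of t] by (simp add: u_def numeral_2_eq_2)
  moreover have "harm (Suc t) = harm t + u" by (simp add: harm_Suc u_def inverse_eq_divide)
  moreover have "harm2 (Suc t) = harm2 t + u ^ 2" by (simp add: harm2_def u_def power_divide)
  ultimately show ?case using Suc by (simp add: power2_eq_square algebra_simps)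
qed

section \<open>Iterated derivatives of \<open>ln x ^ p / x\<close>\<close>

text \<open>The polynomial obtained from \<open>y ^ p\<close> by the operators \<open>1 - D / i\<close> with \<open>1 \<le> i \<le> j\<close>, where
  \<open>D = d / dy\<close>.\<close>

definition log_poly :: "nat \<Rightarrow> nat \<Rightarrow> real \<Rightarrow> real" where
  "log_poly p j y = (\<Sum>r\<le>p. (-1) ^ r * fact p / fact (p - r) * recip_sum r 1 j * y ^ (p - r))"

lemma log_poly_0: "log_poly p 0 y = y ^ p"
  unfolding log_poly_def by (subst sum.atMost_shift) (simp add: recip_sum_0 recip_sum_eq_0[simplified])

lemma log_poly_at_0: "log_poly p j 0 = (-1) ^ p * fact p * recip_sum p 1 j"
proof -
  have "log_poly p j 0 = (\<Sum>r\<in>{p}. (-1) ^ r * fact p / fact (p - r) * recip_sum r 1 j * 0 ^ (p - r))"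
    unfolding log_poly_def by (rule sum.mono_neutral_right) auto
  thus ?thesis by simp
qed

text \<open>This is the recursion \<open>log_poly p (Suc j) = (1 - D / Suc j) (log_poly p j)\<close>. The derivative of the
  term of index \<open>r\<close> has the power of \<open>y\<close> of the term of index \<open>Suc r\<close>, and these combine by the recursion
  of \<open>recip_sum\<close>.\<close>

lemma has_real_derivative_log_poly:
  "(log_poly p j has_real_derivative real (Suc j) * (log_poly p j y - log_poly p (Suc j) y)) (at y)"
proof -
  define c :: "nat \<Rightarrow> real" where "c r = (-1) ^ r * fact p / fact (p - r)" for r
  have c_Suc: "c (Suc r) = - (c r * real (p - r))" if "r < p" for r
  proof -
    have "p - r = Suc (p - Suc r)" using that by simp
    hence "fact (p - r) = real (p - r) * fact (p - Suc r)" by (metis fact_Suc)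
    thus ?thesis using that by (simp add: c_def)
  qed
  have "((\<lambda>y. \<Sum>r\<le>p. c r * recip_sum r 1 j * y ^ (p - r)) has_real_derivative
          (\<Sum>r\<le>p. c r * recip_sum r 1 j * (real (p - r) * y ^ (p - r - 1)))) (at y)"
    by (auto intro!: derivative_eq_intros sum.cong)
  also have "(\<Sum>r\<le>p. c r * recip_sum r 1 j * (real (p - r) * y ^ (p - r - 1)))
      = (\<Sum>r<p. c r * recip_sum r 1 j * (real (p - r) * y ^ (p - Suc r)))"
    by (simp flip: lessThan_Suc_atMost)
  also have "\<dots> = (\<Sum>r<p. - (c (Suc r) * recip_sum r 1 j * y ^ (p - Suc r)))"
    by (rule sum.cong) (simp_all add: c_Suc)
  also have "\<dots> = real (Suc j) * (\<Sum>r\<le>p. c r * (recip_sum r 1 j - recip_sum r 1 (Suc j)) * y ^ (p - r))"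
  proof -
    have "real (Suc j) * (c (Suc r) * (recip_sum (Suc r) 1 j - recip_sum (Suc r) 1 (Suc j)) * y ^ (p - Suc r))
        = - (c (Suc r) * recip_sum r 1 j * y ^ (p - Suc r))" for r
      by (subst recip_sum_Suc) (simp del: of_nat_Suc)
    thus ?thesis
      by (subst sum.atMost_shift) (simp only: distrib_left sum_distrib_left, simp add: recip_sum_0)
  qed
  also have "(\<Sum>r\<le>p. c r * (recip_sum r 1 j - recip_sum r 1 (Suc j)) * y ^ (p - r))
      = log_poly p j y - log_poly p (Suc j) y"
    unfolding log_poly_def c_def sum_subtractf[symmetric]
    by (intro sum.cong refl) (simp only: left_diff_distrib right_diff_distrib)
  finally show ?thesis by (simp add: log_poly_def [abs_def] c_def)
qed

text \<open>For \<open>y \<ge> 1\<close> the leading power dominates; this is why the error term carries \<open>ln n ^ p\<close>.\<close>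

lemma abs_log_poly_le: "\<exists>C\<ge>0. \<forall>y\<ge>1. \<bar>log_poly p j y\<bar> \<le> C * y ^ p"
proof (intro exI conjI allI impI)
  let ?c = "\<lambda>r. \<bar>(-1) ^ r * fact p / fact (p - r) * recip_sum r 1 j\<bar>"
  show "0 \<le> (\<Sum>r\<le>p. ?c r)" by (intro sum_nonneg) auto
  fix y :: real assume y: "y \<ge> 1"
  have "\<bar>log_poly p j y\<bar> \<le> (\<Sum>r\<le>p. \<bar>(-1) ^ r * fact p / fact (p - r) * recip_sum r 1 j * y ^ (p - r)\<bar>)"
    unfolding log_poly_def by (rule sum_abs)
  also have "\<dots> \<le> (\<Sum>r\<le>p. ?c r * y ^ p)"
  proof (rule sum_mono)
    fix r
    have "\<bar>y ^ (p - r)\<bar> \<le> y ^ p" using y by (simp add: power_increasing)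
    thus "\<bar>(-1) ^ r * fact p / fact (p - r) * recip_sum r 1 j * y ^ (p - r)\<bar> \<le> ?c r * y ^ p"
      by (simp only: abs_mult[of _ "y ^ (p - r)"]) (rule mult_left_mono, auto)
  qed
  also have "\<dots> = (\<Sum>r\<le>p. ?c r) * y ^ p" by (simp add: sum_distrib_right)
  finally show "\<bar>log_poly p j y\<bar> \<le> (\<Sum>r\<le>p. ?c r) * y ^ p" .
qed

abbreviation log_term :: "nat \<Rightarrow> real \<Rightarrow> real" where
  "log_term p \<equiv> \<lambda>x. ln x ^ p / x"

lemma has_real_derivative_log_poly_ln:
  assumes "x > 0"
  shows "((\<lambda>x. (-1) ^ j * fact j * log_poly p j (ln x) / x ^ (j + 1)) has_real_derivative
           (-1) ^ Suc j * fact (Suc j) * log_poly p (Suc j) (ln x) / x ^ (Suc j + 1)) (at x)"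
proof -
  let ?Q = "log_poly p j (ln x)" and ?Q' = "log_poly p (Suc j) (ln x)"
  have "((\<lambda>x. log_poly p j (ln x)) has_real_derivative (real (Suc j) * (?Q - ?Q')) * (1 / x)) (at x)"
    using assms by (intro DERIV_chain2[OF has_real_derivative_log_poly] DERIV_ln_divide)
  moreover have "((\<lambda>x. x ^ (j + 1)) has_real_derivative real (j + 1) * x ^ j) (at x)"
    using DERIV_pow[of "j + 1" x] by simp
  ultimately have "((\<lambda>x. (-1) ^ j * fact j * log_poly p j (ln x) / x ^ (j + 1)) has_real_derivative
     ((-1) ^ j * fact j * ((real (Suc j) * (?Q - ?Q')) * (1 / x)) * x ^ (j + 1)
       - (-1) ^ j * fact j * ?Q * (real (j + 1) * x ^ j)) / (x ^ (j + 1) * x ^ (j + 1))) (at x)"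
    using assms by (intro DERIV_divide DERIV_cmult) auto
  also have "((-1) ^ j * fact j * ((real (Suc j) * (?Q - ?Q')) * (1 / x)) * x ^ (j + 1)
       - (-1) ^ j * fact j * ?Q * (real (j + 1) * x ^ j)) / (x ^ (j + 1) * x ^ (j + 1))
     = (-1) ^ Suc j * fact (Suc j) * ?Q' / x ^ (Suc j + 1)"
    using assms by (simp add: field_simps)
  finally show ?thesis .
qed

lemma deriv_funpow_log_term:
  "x > 0 \<Longrightarrow> (deriv ^^ j) (log_term p) x = (-1) ^ j * fact j * log_poly p j (ln x) / x ^ (j + 1)"
proof (induction j arbitrary: x)
  case 0
  thus ?case by (simp add: log_poly_0)
next
  case (Suc j)
  have "((deriv ^^ j) (log_term p) has_real_derivative
      (-1) ^ Suc j * fact (Suc j) * log_poly p (Suc j) (ln x) / x ^ (Suc j + 1)) (at x)"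
    by (rule has_field_derivative_transform_within_open[OF has_real_derivative_log_poly_ln, of _ "{0<..}"])
       (use Suc in auto)
  thus ?case by (simp add: DERIV_imp_deriv)
qed

lemma has_real_derivative_deriv_funpow_log_term:
  assumes "x > 0"
  shows "((deriv ^^ j) (log_term p) has_real_derivative (deriv ^^ Suc j) (log_term p) x) (at x)"
  unfolding deriv_funpow_log_term[OF assms]
  by (rule has_field_derivative_transform_within_open[OF has_real_derivative_log_poly_ln, of _ "{0<..}"])
     (use assms in \<open>auto simp: deriv_funpow_log_term\<close>)

section \<open>Decay of logarithmic terms\<close>

text \<open>The derivative is \<open>ln z ^ (p - 1) * (p - ln z) / z\<^sup>2\<close> for \<open>p \<ge> 1\<close>, which is not positive once
  \<open>ln z \<ge> p\<close>.\<close>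

lemma log_term_antimono:
  assumes "exp (real p) \<le> x" "x \<le> y"
  shows "log_term p y \<le> log_term p x"
proof (cases p)
  case 0
  thus ?thesis using assms by (auto intro!: divide_left_mono mult_pos_pos)
next
  case (Suc q)
  show ?thesis
  proof (rule DERIV_nonpos_imp_nonincreasing[OF assms(2)])
    fix z assume "x \<le> z" "z \<le> y"
    hence z: "exp (real p) \<le> z" using assms by linarith
    have z0: "z > 0" using z exp_gt_zero[of "real p"] by linarith
    hence ln: "ln z \<ge> real p" using z by (simp add: ln_ge_iff)
    have "(log_term p has_real_derivative
            (real p * (1 / z * ln z ^ q) * z - ln z ^ p * 1) / (z * z)) (at z)"
      using z0 Suc DERIV_power[OF DERIV_ln_divide[OF z0], of p]
      by (intro DERIV_divide DERIV_ident) auto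
    moreover have "(real p * (1 / z * ln z ^ q) * z - ln z ^ p * 1) / (z * z)
        = - (ln z ^ q * (ln z - real p) / (z * z))"
      using z0 Suc by (simp add: field_simps)
    moreover have "- (ln z ^ q * (ln z - real p) / (z * z)) \<le> 0"
    proof -
      have "ln z \<ge> 0" using ln of_nat_0_le_iff[of p, where ?'a = real] by linarith
      thus ?thesis using ln z0 by simp
    qed
    ultimately show "\<exists>d. (log_term p has_real_derivative d) (at z) \<and> d \<le> 0"
      by metis
  qed
qed

lemma tendsto_ln_power_over_power:
  assumes "j \<ge> 1" shows "(\<lambda>n::nat. ln (real n) ^ q / real n ^ j) \<longlonglongrightarrow> 0"
proof (rule Lim_null_comparison)
  have "((\<lambda>y::real. y ^ q / exp y) \<longlongrightarrow> 0) at_top"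
    by (rule tendsto_power_div_exp_0)
  hence "((\<lambda>x::real. ln x ^ q / exp (ln x)) \<longlongrightarrow> 0) at_top"
    by (rule filterlim_compose) (rule ln_at_top)
  hence "(\<lambda>n. ln (real n) ^ q / exp (ln (real n))) \<longlonglongrightarrow> 0"
    by (rule filterlim_compose) (rule filterlim_real_sequentially)
  thus "(\<lambda>n. ln (real n) ^ q / real n) \<longlonglongrightarrow> 0"
    by (rule Lim_transform_eventually) (auto intro: eventually_mono[OF eventually_gt_at_top[of 0]])
  show "\<forall>\<^sub>F n in sequentially. norm (ln (real n) ^ q / real n ^ j) \<le> ln (real n) ^ q / real n"
    using eventually_ge_at_top[of 1]
  proof eventually_elim
    case (elim n)
    hence "real n \<le> real n ^ j" using assms self_le_power[of "real n" j] by simp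
    thus ?case using elim by (simp add: divide_left_mono)
  qed
qed

lemma convergent_from_tail_bound:
  fixes X b :: "nat \<Rightarrow> real"
  assumes b: "b \<longlonglongrightarrow> 0" and tail: "\<And>n N. n0 \<le> n \<Longrightarrow> n \<le> N \<Longrightarrow> \<bar>X N - X n\<bar> \<le> b n"
  shows "\<exists>L. X \<longlonglongrightarrow> L \<and> (\<forall>n\<ge>n0. \<bar>X n - L\<bar> \<le> b n)"
proof -
  have "Cauchy X"
    unfolding Cauchy_altdef2
  proof (intro allI impI)
    fix e :: real assume "e > 0"
    with b have "\<forall>\<^sub>F n in sequentially. b n < e" by (rule order_tendstoD)
    then obtain k where k: "\<And>n. n \<ge> k \<Longrightarrow> b n < e" by (auto simp: eventually_at_top_linorder)
    have "dist (X n) (X (max k n0)) < e" if "n \<ge> max k n0" for n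
      using tail[of "max k n0" n] k[of "max k n0"] that by (simp add: dist_real_def)
    thus "\<exists>N. \<forall>n\<ge>N. dist (X n) (X N) < e" by blast
  qed
  then obtain L where L: "X \<longlonglongrightarrow> L" using Cauchy_convergent convergent_def by blast
  have "\<bar>X n - L\<bar> \<le> b n" if n: "n \<ge> n0" for n
  proof (rule tendsto_upperbound)
    show "(\<lambda>N. \<bar>X n - X N\<bar>) \<longlonglongrightarrow> \<bar>X n - L\<bar>" by (intro tendsto_intros L)
    show "\<forall>\<^sub>F N in sequentially. \<bar>X n - X N\<bar> \<le> b n"
      using eventually_ge_at_top[of n] proof eventually_elim
        case (elim N)
        thus ?case using tail[OF n elim] by (simp only: abs_minus_commute)
      qed
  qed simp
  with L show ?thesis by blast
qed

section \<open>The remainder for \<open>ln x ^ p / x\<close>\<close>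

lemma smooth_log_term:
  "x \<ge> 1 \<Longrightarrow> ((deriv ^^ j) (log_term p) has_real_derivative (deriv ^^ Suc j) (log_term p) x) (at x)"
  by (rule has_real_derivative_deriv_funpow_log_term) simp

lemma has_real_derivative_neg_inverse_power:
  fixes x :: real
  assumes "x > 0"
  shows "((\<lambda>x. - 1 / (real (Suc k) * x ^ Suc k)) has_real_derivative 1 / x ^ (Suc k + 1)) (at x within S)"
proof -
  have "((\<lambda>x. - 1 / (real (Suc k) * x ^ Suc k)) has_real_derivative
          (0 * (real (Suc k) * x ^ Suc k) - (- 1) * (real (Suc k) * (real (Suc k) * x ^ k)))
             / ((real (Suc k) * x ^ Suc k) * (real (Suc k) * x ^ Suc k))) (at x within S)"
    using assms DERIV_pow[of "Suc k" x S]
    by (intro DERIV_divide DERIV_const DERIV_cmult) (auto simp del: of_nat_Suc power_Suc)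
  also have "(0 * (real (Suc k) * x ^ Suc k) - (- 1) * (real (Suc k) * (real (Suc k) * x ^ k)))
             / ((real (Suc k) * x ^ Suc k) * (real (Suc k) * x ^ Suc k)) = 1 / x ^ (Suc k + 1)"
    using assms by (simp add: divide_simps del: of_nat_Suc)
  finally show ?thesis .
qed

text \<open>The integrand is at most \<open>K * (ln x ^ p / x) / x ^ (2 * m + 1)\<close>. For \<open>x \<ge> n\<close> the monotone factor
  \<open>ln x ^ p / x\<close> can be replaced by its value at \<open>n\<close>, so that only a pure power remains to be integrated.
  This power is integrable at infinity as \<open>m \<ge> 1\<close>.\<close>

lemma em_remainder_log_term_tail:
  assumes m: "m \<ge> 1"
  shows "\<exists>C n0. \<forall>n\<ge>n0. \<forall>N\<ge>n. \<bar>em_remainder (log_term p) m N - em_remainder (log_term p) m n\<bar>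
           \<le> C * (ln (real n) ^ p / real n ^ (2 * m + 1))"
proof -
  let ?j = "2 * m + 1"
  let ?F = "\<lambda>x. bernoulli_poly ?j (frac x) * (deriv ^^ ?j) (log_term p) x"
  have "compact (bernoulli_poly ?j ` {0..1})"
    by (intro compact_continuous_image continuous_intros) auto
  then obtain M where M: "\<And>t. t \<in> {0..1} \<Longrightarrow> \<bar>bernoulli_poly ?j t\<bar> \<le> M"
    using compact_imp_bounded[of "bernoulli_poly ?j ` {0..1}"] unfolding bounded_iff
    by (metis imageI real_norm_def)
  have M0: "M \<ge> 0" using M[of 0] by force
  obtain C where C0: "C \<ge> 0" and C: "\<And>y. y \<ge> 1 \<Longrightarrow> \<bar>log_poly p ?j y\<bar> \<le> C * y ^ p"
    using abs_log_poly_le by meson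
  \<comment> \<open>From \<open>exp p\<close> on, \<open>ln x ^ p / x\<close> decreases; from \<open>exp 1\<close> on, \<open>ln x \<ge> 1\<close>. The exponent
    \<open>p + 1\<close> covers both.\<close>
  define n0 where "n0 = nat \<lceil>exp (real p + 1)\<rceil>"
  define K where "K = M * (fact ?j * C)"
  have K0: "K \<ge> 0" unfolding K_def using M0 C0 by simp
  have "\<bar>em_remainder (log_term p) m N - em_remainder (log_term p) m n\<bar>
           \<le> K / (real (2 * m) * fact ?j) * (ln (real n) ^ p / real n ^ ?j)" if nN: "n0 \<le> n" "n \<le> N" for n N
  proof -
    have n: "exp (real p + 1) \<le> real n"
      using nN(1) unfolding n0_def by linarith
    have n_ge: "exp (real p) \<le> real n" "exp 1 \<le> real n"
      using n by (force intro: order_trans[rotated])+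
    have n0: "real n > 0" using n_ge exp_gt_zero[of 1] by linarith
    hence n1: "n \<ge> 1" by simp
    have cont: "continuous_on {1..} ((deriv ^^ ?j) (log_term p))"
      by (rule DERIV_continuous_on[OF has_field_derivative_at_within[OF smooth_log_term]]) simp
    have int: "?F integrable_on {1..real N}"
      by (rule has_integral_integrable[OF has_integral_periodic_kernel[OF _ cont]])
         (use n1 nN in \<open>auto intro!: continuous_intros\<close>)
    have "integral {1..real n} ?F + integral {real n..real N} ?F = integral {1..real N} ?F"
      using n1 nN by (intro Henstock_Kurzweil_Integration.integral_combine int) auto
    hence diff: "em_remainder (log_term p) m N - em_remainder (log_term p) m n
        = integral {real n..real N} ?F / fact ?j"
      by (simp only: em_remainder_def diff_divide_distrib[symmetric]) simp
    let ?b = "K * (ln (real n) ^ p / real n)"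
    let ?G = "\<lambda>x::real. - 1 / (real (2 * m) * x ^ (2 * m))"
    have G: "((\<lambda>x. ?b * (1 / x ^ ?j)) has_integral ?b * (?G (real N) - ?G (real n))) {real n..real N}"
    proof (intro has_integral_mult_right fundamental_theorem_of_calculus)
      fix x assume "x \<in> {real n..real N}"
      hence "x > 0" using n0 by simp
      hence "(?G has_real_derivative 1 / x ^ ?j) (at x within {real n..real N})"
        using has_real_derivative_neg_inverse_power[of x "2 * m - 1"] m by simp
      thus "(?G has_vector_derivative 1 / x ^ ?j) (at x within {real n..real N})"
        by (simp add: has_real_derivative_iff_has_vector_derivative)
    qed (use nN in simp)
    have "norm (integral {real n..real N} ?F) \<le> integral {real n..real N} (\<lambda>x. ?b * (1 / x ^ ?j))"
    proof (rule integral_norm_bound_integral)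
      show "?F integrable_on {real n..real N}"
        using n1 by (intro integrable_on_subinterval[OF int]) auto
      show "(\<lambda>x. ?b * (1 / x ^ ?j)) integrable_on {real n..real N}"
        using G by (rule has_integral_integrable)
      fix x assume "x \<in> {real n..real N}"
      hence x: "real n \<le> x" by simp
      have x0: "x > 0" using x n0 by simp
      have ln1: "ln x \<ge> 1" using x x0 n_ge(2) by (simp add: ln_ge_iff)
      have "\<bar>(deriv ^^ ?j) (log_term p) x\<bar> = fact ?j * \<bar>log_poly p ?j (ln x)\<bar> / x ^ (?j + 1)"
        using x0 by (simp only: deriv_funpow_log_term abs_mult abs_divide power_abs) simp
      also have "\<dots> \<le> fact ?j * (C * ln x ^ p) / x ^ (?j + 1)"
        using x0 C[OF ln1] by (intro divide_right_mono mult_left_mono) auto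
      also have "\<dots> = fact ?j * C * log_term p x * (1 / x ^ ?j)"
        by (simp add: field_simps del: fact_Suc)
      also have "\<dots> \<le> fact ?j * C * log_term p (real n) * (1 / x ^ ?j)"
        using log_term_antimono[OF n_ge(1) x] x0 C0
        by (intro mult_right_mono mult_left_mono) auto
      finally have g: "\<bar>(deriv ^^ ?j) (log_term p) x\<bar> \<le> fact ?j * C * log_term p (real n) * (1 / x ^ ?j)" .
      have "\<bar>bernoulli_poly ?j (frac x)\<bar> \<le> M"
        by (rule M) (simp add: frac_lt_1 less_imp_le)
      hence "\<bar>?F x\<bar> \<le> M * (fact ?j * C * log_term p (real n) * (1 / x ^ ?j))"
        unfolding abs_mult using g M0 by (intro mult_mono) auto
      thus "norm (?F x) \<le> ?b * (1 / x ^ ?j)" by (simp add: K_def mult_ac del: fact_Suc)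
    qed
    also have "\<dots> = ?b * (?G (real N) - ?G (real n))" using G by (rule integral_unique)
    also have "\<dots> \<le> ?b * (1 / (real (2 * m) * real n ^ (2 * m)))"
      using K0 n0 n1 by (intro mult_left_mono) (auto intro!: divide_nonneg_nonneg mult_nonneg_nonneg)
    finally have "\<bar>integral {real n..real N} ?F\<bar> \<le> ?b * (1 / (real (2 * m) * real n ^ (2 * m)))" by simp
    hence "\<bar>em_remainder (log_term p) m N - em_remainder (log_term p) m n\<bar>
       \<le> ?b * (1 / (real (2 * m) * real n ^ (2 * m))) / fact ?j"
      unfolding diff abs_divide abs_of_pos[OF fact_gt_zero] by (rule divide_right_mono) simp
    also have "\<dots> = K / (real (2 * m) * fact ?j) * (ln (real n) ^ p / real n ^ ?j)"
      by (simp add: field_simps del: fact_Suc)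
    finally show ?thesis .
  qed
  thus ?thesis by blast
qed

lemma em_remainder_log_term_limit:
  assumes m: "m \<ge> 1"
  obtains L where "em_remainder (log_term p) m \<longlonglongrightarrow> L"
    and "(\<lambda>n. em_remainder (log_term p) m n - L) \<in> O(\<lambda>n. ln (real n) ^ p / real n ^ (2 * m + 1))"
proof -
  obtain C n0 where tail: "\<And>n N. n0 \<le> n \<Longrightarrow> n \<le> N \<Longrightarrow>
      \<bar>em_remainder (log_term p) m N - em_remainder (log_term p) m n\<bar>
         \<le> C * (ln (real n) ^ p / real n ^ (2 * m + 1))"
    using em_remainder_log_term_tail[OF m] by blast
  have "(\<lambda>n. C * (ln (real n) ^ p / real n ^ (2 * m + 1))) \<longlonglongrightarrow> C * 0"
    by (intro tendsto_mult_left tendsto_ln_power_over_power) simp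
  hence "(\<lambda>n. C * (ln (real n) ^ p / real n ^ (2 * m + 1))) \<longlonglongrightarrow> 0" by simp
  from convergent_from_tail_bound[OF this tail] obtain L where
    L: "em_remainder (log_term p) m \<longlonglongrightarrow> L"
    and bnd: "\<forall>n\<ge>n0. \<bar>em_remainder (log_term p) m n - L\<bar> \<le> C * (ln (real n) ^ p / real n ^ (2 * m + 1))"
    by blast
  have "\<forall>\<^sub>F n in sequentially. norm (em_remainder (log_term p) m n - L)
          \<le> \<bar>C\<bar> * norm (ln (real n) ^ p / real n ^ (2 * m + 1))"
    using eventually_ge_at_top[of n0]
  proof eventually_elim
    case (elim n)
    with bnd have "\<bar>em_remainder (log_term p) m n - L\<bar> \<le> C * (ln (real n) ^ p / real n ^ (2 * m + 1))" by blast
    also have "\<dots> \<le> \<bar>C * (ln (real n) ^ p / real n ^ (2 * m + 1))\<bar>" by (rule abs_ge_self)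
    finally show ?case by (simp only: abs_mult real_norm_def)
  qed
  from bigoI[OF this] L show ?thesis using that by blast
qed

section \<open>Expansion of the sum and the Stieltjes constants\<close>

text \<open>The contribution of the lower limit \<open>1\<close>, that is, the formal series for \<open>stieltjes p\<close>
  truncated at order \<open>m\<close>. Terms of index \<open>k \<le> p / 2\<close> may be included since they are zero.\<close>

definition lower_terms :: "nat \<Rightarrow> nat \<Rightarrow> real" where
  "lower_terms p m = (if p = 0 then 1 / 2 else 0)
     + (\<Sum>k=1..m. (-1) ^ p * fact p * (bernoulli_num (2 * k) / real (2 * k) * recip_sum p 1 (2 * k - 1)))"

lemma fact_double: "k \<ge> 1 \<Longrightarrow> fact (2 * k) = real (2 * k) * fact (2 * k - 1)"
  by (rule fact_reduce) simp

lemma em_term: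
  assumes "k \<ge> 1" "x > 0"
  shows "bernoulli_num (2 * k) / fact (2 * k) * (deriv ^^ (2 * k - 1)) (log_term p) x
           = - (bernoulli_num (2 * k) / real (2 * k) * log_poly p (2 * k - 1) (ln x) / x ^ (2 * k))"
proof -
  have "odd (2 * k - 1)" "2 * k - 1 + 1 = 2 * k" using assms by auto
  thus ?thesis
    by (simp only: deriv_funpow_log_term[OF assms(2)] fact_double[OF assms(1)] power_minus_odd power_one) simp
qed

lemma em_term_at_1:
  assumes "k \<ge> 1"
  shows "- (bernoulli_num (2 * k) / fact (2 * k)) * (deriv ^^ (2 * k - 1)) (log_term p) 1
           = (-1) ^ p * fact p * (bernoulli_num (2 * k) / real (2 * k) * recip_sum p 1 (2 * k - 1))"
proof -
  have "- (bernoulli_num (2 * k) / fact (2 * k)) * (deriv ^^ (2 * k - 1)) (log_term p) 1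
      = bernoulli_num (2 * k) / real (2 * k) * log_poly p (2 * k - 1) 0"
    using em_term[OF assms, of 1 p] by simp
  thus ?thesis by (simp add: log_poly_at_0)
qed

lemma d_coeff_sum:
  "(\<Sum>r=0..p. d_coeff p k r * y ^ (p - r)) = bernoulli_num (2 * k) / real (2 * k) * log_poly p (2 * k - 1) y"
  by (simp add: d_coeff_def log_poly_def sum_distrib_left atMost_atLeast0 mult.assoc)

lemma euler_maclaurin_log_term_derivs:
  assumes n: "n \<ge> 1"
  shows "(\<Sum>k=1..n. log_term p (real k)) =
           integral {1..real n} (log_term p) + log_term p (real n) / 2
           + (\<Sum>k=1..m. bernoulli_num (2 * k) / fact (2 * k) * (deriv ^^ (2 * k - 1)) (log_term p) (real n))
           + lower_terms p m + em_remainder (log_term p) m n"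
proof -
  have "(\<Sum>k=1..m. bernoulli_num (2 * k) / fact (2 * k)
            * ((deriv ^^ (2 * k - 1)) (log_term p) (real n) - (deriv ^^ (2 * k - 1)) (log_term p) 1))
      = (\<Sum>k=1..m. bernoulli_num (2 * k) / fact (2 * k) * (deriv ^^ (2 * k - 1)) (log_term p) (real n)
           + (-1) ^ p * fact p * (bernoulli_num (2 * k) / real (2 * k) * recip_sum p 1 (2 * k - 1)))"
  proof (rule sum.cong[OF refl])
    fix k assume "k \<in> {1..m}"
    hence "k \<ge> 1" by simp
    from em_term_at_1[OF this, of p] show
      "bernoulli_num (2 * k) / fact (2 * k)
            * ((deriv ^^ (2 * k - 1)) (log_term p) (real n) - (deriv ^^ (2 * k - 1)) (log_term p) 1)
       = bernoulli_num (2 * k) / fact (2 * k) * (deriv ^^ (2 * k - 1)) (log_term p) (real n)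
           + (-1) ^ p * fact p * (bernoulli_num (2 * k) / real (2 * k) * recip_sum p 1 (2 * k - 1))"
      by (simp only: right_diff_distrib)
  qed
  moreover have "log_term p 1 / 2 = (if p = 0 then 1 / 2 else 0)" by simp
  ultimately show ?thesis
    using euler_maclaurin[OF smooth_log_term n, of p m]
    unfolding lower_terms_def sum.distrib add_divide_distrib by linarith
qed

lemma integral_log_term:
  assumes "n \<ge> 1"
  shows "integral {1..real n} (log_term p) = ln (real n) ^ (p + 1) / real (p + 1)"
proof -
  have "(log_term p has_integral ln (real n) ^ (p + 1) / real (p + 1) - ln 1 ^ (p + 1) / real (p + 1)) {1..real n}"
  proof (rule fundamental_theorem_of_calculus)
    fix x assume "x \<in> {1..real n}"
    hence x: "x > 0" by simp
    have "((\<lambda>x. ln x ^ (p + 1) / real (p + 1)) has_real_derivative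
            (real (p + 1) * (1 / x * ln x ^ p)) / real (p + 1)) (at x within {1..real n})"
      using DERIV_power[OF has_field_derivative_at_within[OF DERIV_ln_divide[OF x]], of "p + 1"]
      by (intro DERIV_cdivide) simp
    also have "(real (p + 1) * (1 / x * ln x ^ p)) / real (p + 1) = log_term p x" by simp
    finally show "((\<lambda>x. ln x ^ (p + 1) / real (p + 1)) has_vector_derivative log_term p x)
        (at x within {1..real n})"
      by (simp add: has_real_derivative_iff_has_vector_derivative)
  qed (use assms in simp)
  thus ?thesis by (simp add: integral_unique)
qed

text \<open>The contribution of the upper limit \<open>n\<close> apart from the integral: the part of the expansion that
  tends to \<open>0\<close>.\<close>

definition upper_terms :: "nat \<Rightarrow> nat \<Rightarrow> nat \<Rightarrow> real" where
  "upper_terms p m n = 1 / 2 * log_term p (real n)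
     - (\<Sum>k=1..m. (\<Sum>r=0..p. d_coeff p k r * ln (real n) ^ (p - r)) / real n ^ (2 * k))"

lemma euler_maclaurin_log_term:
  assumes n: "n \<ge> 1"
  shows "(\<Sum>k=1..n. log_term p (real k)) = ln (real n) ^ (p + 1) / real (p + 1) + upper_terms p m n
           + (lower_terms p m + em_remainder (log_term p) m n)"
proof -
  have "(\<Sum>k=1..m. bernoulli_num (2 * k) / fact (2 * k) * (deriv ^^ (2 * k - 1)) (log_term p) (real n))
      = - (\<Sum>k=1..m. (\<Sum>r=0..p. d_coeff p k r * ln (real n) ^ (p - r)) / real n ^ (2 * k))"
    unfolding sum_negf[symmetric] d_coeff_sum
    by (rule sum.cong[OF refl]) (use n in \<open>auto simp only: em_term atLeastAtMost_iff of_nat_0_less_iff\<close>)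
  thus ?thesis
    by (simp only: euler_maclaurin_log_term_derivs[OF n, of p m] integral_log_term[OF n] upper_terms_def) simp
qed

lemma upper_terms_tendsto_0: "upper_terms p m \<longlonglongrightarrow> 0"
proof -
  have "(\<lambda>n. (\<Sum>r=0..p. d_coeff p k r * ln (real n) ^ (p - r)) / real n ^ (2 * k)) \<longlonglongrightarrow> 0" if "k \<in> {1..m}" for k
    unfolding sum_divide_distrib times_divide_eq_right[symmetric]
    by (intro tendsto_null_sum tendsto_mult_right_zero tendsto_ln_power_over_power) (use that in auto)
  moreover have "(\<lambda>n. log_term p (real n)) \<longlonglongrightarrow> 0"
    using tendsto_ln_power_over_power[of 1 p] by simp
  ultimately have "(\<lambda>n. 1 / 2 * log_term p (real n) -
      (\<Sum>k=1..m. (\<Sum>r=0..p. d_coeff p k r * ln (real n) ^ (p - r)) / real n ^ (2 * k))) \<longlonglongrightarrow> 1 / 2 * 0 - 0"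
    by (intro tendsto_diff tendsto_mult_left tendsto_null_sum)
  thus ?thesis by (simp add: upper_terms_def [abs_def])
qed

text \<open>The limit in the definition of \<open>stieltjes p\<close> exists because the remainder of order \<open>1\<close> converges.\<close>

lemma stieltjes_LIMSEQ:
  "(\<lambda>n. (\<Sum>k=1..n. ln (real k) ^ p / real k) - ln (real n) ^ (p + 1) / real (p + 1)) \<longlonglongrightarrow> stieltjes p"
proof -
  obtain L where "em_remainder (log_term p) 1 \<longlonglongrightarrow> L"
    by (rule em_remainder_log_term_limit[of 1 p]) simp
  hence "(\<lambda>n. upper_terms p 1 n + (lower_terms p 1 + em_remainder (log_term p) 1 n)) \<longlonglongrightarrow> 0 + (lower_terms p 1 + L)"
    by (intro tendsto_intros upper_terms_tendsto_0)
  moreover have "\<forall>\<^sub>F n in sequentially. upper_terms p 1 n + (lower_terms p 1 + em_remainder (log_term p) 1 n)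
      = (\<Sum>k=1..n. ln (real k) ^ p / real k) - ln (real n) ^ (p + 1) / real (p + 1)"
    using eventually_ge_at_top[of 1]
    by eventually_elim (simp only: euler_maclaurin_log_term[of _ p 1])
  ultimately have "(\<lambda>n. (\<Sum>k=1..n. ln (real k) ^ p / real k) - ln (real n) ^ (p + 1) / real (p + 1))
      \<longlonglongrightarrow> 0 + (lower_terms p 1 + L)"
    by (rule Lim_transform_eventually)
  thus ?thesis unfolding stieltjes_def by (simp add: limI)
qed

text \<open>The sum is independent of \<open>m\<close> and the upper-limit terms vanish at infinity, so whatever the lower
  limit and the remainder contribute has the same limit at each order. In particular this includes
  \<open>m = 0\<close>, where the tail estimate says nothing.\<close>

lemma lower_terms_plus_remainder_LIMSEQ:
  "(\<lambda>n. lower_terms p m + em_remainder (log_term p) m n) \<longlonglongrightarrow> stieltjes p"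
proof -
  have "(\<lambda>n. (\<Sum>k=1..n. ln (real k) ^ p / real k) - ln (real n) ^ (p + 1) / real (p + 1) - upper_terms p m n)
          \<longlonglongrightarrow> stieltjes p - 0"
    by (intro tendsto_diff stieltjes_LIMSEQ upper_terms_tendsto_0)
  moreover have "\<forall>\<^sub>F n in sequentially.
      (\<Sum>k=1..n. ln (real k) ^ p / real k) - ln (real n) ^ (p + 1) / real (p + 1) - upper_terms p m n
      = lower_terms p m + em_remainder (log_term p) m n"
    using eventually_ge_at_top[of 1]
    by eventually_elim (simp only: euler_maclaurin_log_term[of _ p m])
  ultimately have "(\<lambda>n. lower_terms p m + em_remainder (log_term p) m n) \<longlonglongrightarrow> stieltjes p - 0"
    by (rule Lim_transform_eventually)
  thus ?thesis by simp
qed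

text \<open>The error is the remainder minus its limit, which the tail estimate controls at the required
  rate.\<close>

lemma log_sum_asymptotics:
  assumes m: "m \<ge> 1"
  shows "(\<lambda>n. (\<Sum>k=1..n. ln (real k) ^ p / real k)
            - (1 / real (p + 1) * ln (real n) ^ (p + 1) + stieltjes p + 1 / 2 * (ln (real n) ^ p / real n)
              - (\<Sum>k=1..m. (\<Sum>r=0..p. d_coeff p k r * ln (real n) ^ (p - r)) / real n ^ (2 * k))))
        \<in> O(\<lambda>n. ln (real n) ^ p / real n ^ (2 * m + 1))"
proof -
  obtain L where L: "em_remainder (log_term p) m \<longlonglongrightarrow> L"
    and O: "(\<lambda>n. em_remainder (log_term p) m n - L) \<in> O(\<lambda>n. ln (real n) ^ p / real n ^ (2 * m + 1))"
    using em_remainder_log_term_limit[OF m] .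
  have "(\<lambda>n. lower_terms p m + em_remainder (log_term p) m n) \<longlonglongrightarrow> lower_terms p m + L"
    by (intro tendsto_intros L)
  hence st: "stieltjes p = lower_terms p m + L"
    using lower_terms_plus_remainder_LIMSEQ LIMSEQ_unique by blast
  have "\<forall>\<^sub>F n in sequentially. em_remainder (log_term p) m n - L =
      (\<Sum>k=1..n. ln (real k) ^ p / real k)
            - (1 / real (p + 1) * ln (real n) ^ (p + 1) + stieltjes p + 1 / 2 * (ln (real n) ^ p / real n)
              - (\<Sum>k=1..m. (\<Sum>r=0..p. d_coeff p k r * ln (real n) ^ (p - r)) / real n ^ (2 * k)))"
    using eventually_ge_at_top[of 1]
    by eventually_elim (simp only: euler_maclaurin_log_term[of _ p m] upper_terms_def st, simp)
  from landau_o.big.in_cong[OF this] O show ?thesis by simp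
qed

section \<open>The formal constant term\<close>

lemma recip_sum_eq_0_of_low_order: "k \<ge> 1 \<Longrightarrow> \<not> real k > real p / 2 \<Longrightarrow> recip_sum p 1 (2 * k - 1) = 0"
  by (rule recip_sum_eq_0) linarith

lemma formal_em_constant_log_term:
  "formal_em_constant (log_term p) (if p = 0 then 1 / 2 else 0) {k. real k > real p / 2}
     (\<lambda>k. (-1) ^ p * fact p * (bernoulli_num (2 * k) / real (2 * k) * recip_sum p 1 (2 * k - 1)))
     (stieltjes p)"
proof -
  let ?K = "{k. real k > real p / 2}"
  let ?a = "\<lambda>k. (-1) ^ p * fact p * (bernoulli_num (2 * k) / real (2 * k) * recip_sum p 1 (2 * k - 1))"
  have a: "?a k = 0" if "k \<ge> 1" "k \<notin> ?K" for k
    using recip_sum_eq_0_of_low_order[of k p] that by simp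
  have "(\<Sum>k\<in>?K \<inter> {1..m}. ?a k) = (\<Sum>k=1..m. ?a k)" for m
    by (rule sum.mono_neutral_left, simp, blast, intro ballI a) auto
  hence c: "(if p = 0 then 1 / 2 else 0) + (\<Sum>k\<in>?K \<inter> {1..m}. ?a k) = lower_terms p m" for m
    by (simp only: lower_terms_def)
  have "- (bernoulli_num (2 * k) / fact (2 * k)) * (deriv ^^ (2 * k - 1)) (log_term p) 1
      = (if k \<in> ?K then ?a k else 0)" if "k \<ge> 1" for k
    using a[OF that] em_term_at_1[OF that, of p] by presburger
  moreover have "(if p = 0 then 1 / 2 else 0) = log_term p 1 / 2" by simp
  ultimately show ?thesis
    unfolding formal_em_constant_def c
    using euler_maclaurin_log_term_derivs[of _ p] lower_terms_plus_remainder_LIMSEQ[of p] by blast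
qed

text \<open>The index set matters only through the sequence extended by zero. For \<open>p = 2\<close> this allows adding
  the vanishing term \<open>k = 1\<close>.\<close>

lemma formal_em_constant_cong:
  assumes "\<And>k. k \<ge> 1 \<Longrightarrow> (if k \<in> K then a k else 0) = (if k \<in> K' then a' k else 0)"
  shows "formal_em_constant f c K a C \<longleftrightarrow> formal_em_constant f c K' a' C"
proof -
  have "(\<Sum>k\<in>K \<inter> {1..m}. a k) = (\<Sum>k\<in>K' \<inter> {1..m}. a' k)" for m
  proof -
    have "(\<Sum>k\<in>K \<inter> {1..m}. a k) = (\<Sum>k=1..m. if k \<in> K then a k else 0)"
      by (subst Int_commute) (rule sum.inter_restrict, simp)
    also have "\<dots> = (\<Sum>k=1..m. if k \<in> K' then a' k else 0)"
      by (rule sum.cong[OF refl]) (use assms in auto)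
    also have "\<dots> = (\<Sum>k\<in>K' \<inter> {1..m}. a' k)"
      by (subst Int_commute) (rule sum.inter_restrict [symmetric], simp)
    finally show ?thesis .
  qed
  thus ?thesis unfolding formal_em_constant_def using assms by simp
qed

lemma d_coeff_2_sum:
  "(\<Sum>r=0..2. d_coeff 2 k r * y ^ (2 - r)) = bernoulli_num (2 * k) / real (2 * k)
     * (y ^ 2 - 2 * harm (2 * k - 1) * y + harm (2 * k - 1) ^ 2 - harm2 (2 * k - 1))"
proof -
  have "log_poly 2 j y = y ^ 2 - 2 * recip_sum 1 1 j * y + 2 * recip_sum 2 1 j" for j
    by (simp add: log_poly_def recip_sum_0 numeral_2_eq_2)
  thus ?thesis unfolding d_coeff_sum recip_sum_1 recip_sum_2 by simp
qed

theorem lemma4p2: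
  shows
    "(\<forall>p m :: nat. m \<ge> 1 \<longrightarrow>
        (\<lambda>n::nat. (\<Sum>k=1..n. ln (real k) ^ p / real k)
           - (1 / real (p + 1) * ln (real n) ^ (p + 1) + stieltjes p
              + 1 / 2 * (ln (real n) ^ p / real n)
              - (\<Sum>k=1..m. (\<Sum>r=0..p. d_coeff p k r * ln (real n) ^ (p - r)) / real n ^ (2 * k))))
        \<in> O(\<lambda>n::nat. ln (real n) ^ p / real n ^ (2 * m + 1)))
   \<and> (\<forall>p :: nat.
        formal_em_constant (\<lambda>x. ln x ^ p / x)
          (if p = 0 then 1 / 2 else 0)
          {k. real k > real p / 2}
          (\<lambda>k. (- 1) ^ p * fact p
                 * (bernoulli_num (2 * k) / real (2 * k) * recip_sum p 1 (2 * k - 1)))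
          (stieltjes p))
   \<and> (\<forall>m :: nat. m \<ge> 1 \<longrightarrow>
        (\<lambda>n::nat. (\<Sum>k=1..n. ln (real k) ^ 2 / real k)
           - (ln (real n) ^ 3 / 3 + stieltjes 2 + 1 / 2 * (ln (real n) ^ 2 / real n)
              - (\<Sum>k=1..m. bernoulli_num (2 * k) / real (2 * k)
                   * ((ln (real n) ^ 2 - 2 * harm (2 * k - 1) * ln (real n)
                       + harm (2 * k - 1) ^ 2 - harm2 (2 * k - 1)) / real n ^ (2 * k)))))
        \<in> O(\<lambda>n::nat. ln (real n) ^ 2 / real n ^ (2 * m + 1)))
   \<and> formal_em_constant (\<lambda>x. ln x ^ 2 / x)
        0
        {k. k \<ge> 1}
        (\<lambda>k. bernoulli_num (2 * k) * (harm (2 * k - 1) ^ 2 - harm2 (2 * k - 1)) / real (2 * k))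
        (stieltjes 2)"
proof (intro conjI allI impI)
  fix m :: nat assume "m \<ge> 1"
  moreover have "1 / real (2 + 1) * ln x ^ (2 + 1) = ln x ^ 3 / 3" for x by simp
  ultimately show "(\<lambda>n::nat. (\<Sum>k=1..n. ln (real k) ^ 2 / real k)
           - (ln (real n) ^ 3 / 3 + stieltjes 2 + 1 / 2 * (ln (real n) ^ 2 / real n)
              - (\<Sum>k=1..m. bernoulli_num (2 * k) / real (2 * k)
                   * ((ln (real n) ^ 2 - 2 * harm (2 * k - 1) * ln (real n)
                       + harm (2 * k - 1) ^ 2 - harm2 (2 * k - 1)) / real n ^ (2 * k)))))
        \<in> O(\<lambda>n::nat. ln (real n) ^ 2 / real n ^ (2 * m + 1))"
    using log_sum_asymptotics[of m 2] by (simp only: d_coeff_2_sum times_divide_eq_right)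
next
  have "formal_em_constant (log_term 2) 0 {k. real k > real 2 / 2}
     (\<lambda>k. (-1) ^ 2 * fact 2 * (bernoulli_num (2 * k) / real (2 * k) * recip_sum 2 1 (2 * k - 1)))
     (stieltjes 2)"
    using formal_em_constant_log_term[of 2] by simp
  moreover have "(if k \<in> {k. real k > real 2 / 2}
       then (-1) ^ 2 * fact 2 * (bernoulli_num (2 * k) / real (2 * k) * recip_sum 2 1 (2 * k - 1)) else 0)
     = (if k \<in> {k. k \<ge> 1}
       then bernoulli_num (2 * k) * (harm (2 * k - 1) ^ 2 - harm2 (2 * k - 1)) / real (2 * k) else 0)"
    if "k \<ge> 1" for k
    using that recip_sum_eq_0_of_low_order[of k 2] by (simp flip: recip_sum_2)
  note formal_em_constant_cong[OF this]
  ultimately show "formal_em_constant (log_term 2) 0 {k. k \<ge> 1}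
        (\<lambda>k. bernoulli_num (2 * k) * (harm (2 * k - 1) ^ 2 - harm2 (2 * k - 1)) / real (2 * k))
        (stieltjes 2)"
    by (simp only:)
qed (use log_sum_asymptotics formal_em_constant_log_term in auto)

end
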